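(* Let $X$ be an F-space, $Y$ a separable metrizable topological vector space, and $T_n: X \rightarrow Y$, $n\geq 0$, operators (i.e. continuous linear maps). Let $\mathcal{A}=\bigcup_{\delta\in D} \mathcal{A}_\delta$ be an upper Furstenberg family. Suppose that there are a dense subset $X_0$ of $X$, a dense subset $Y_0$ of $Y$ and mappings $S_n:Y_0\rightarrow X$, $n\geq 0$, with the following property: for any $y\in Y_0$ and $\varepsilon>0$ there exist $A\in\mathcal{A}$ and $\delta\in D$ such that (i) for any $x\in X_0$ there is some $B\in \mathcal{A}_\delta$, $B\subset A$, such that, for any $n\in B$, $\|T_nx\|<\varepsilon$; (ii) $\sum _{n\in A} S_n y$ converges (in $X$); (iii) for any $m\in A$, $\big\|T_m \sum _{n\in A} S_n y-y\big\| <\varepsilon$. Then $(T_n)$ is $\mathcal{A}$-universal with a residual set of $\mathcal{A}$-universal vectors.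
   Context: Let $\mathbb{N}_0=\{0,1,2,\ldots\}$. For $A\subset\mathbb{N}_0$ and $n\geq 0$, $A-n=\{k-n : k\in A, k\geq n\}$. A Furstenberg family is a non-empty family $\mathcal{A}$ of subsets of $\mathbb{N}_0$ that is hereditary upward: $A\in\mathcal{A}$, $B\supset A$ imply $B\in\mathcal{A}$. It is proper if $\varnothing\notin\mathcal{A}$. A Furstenberg family $\mathcal{A}$ is called upper if it is proper and it can be written as $\mathcal{A} = \bigcup_{\delta\in D} \mathcal{A}_{\delta}$ with $\mathcal{A}_{\delta}=\bigcap_{\mu\in M} \mathcal{A}_{\delta,\mu}$ for some families $\mathcal{A}_{\delta,\mu}$ of subsets of $\mathbb{N}_0$ ($\delta\in D,\mu\in M$), where the index set $D$ is arbitrary but $M$ is countable, and such that: (1) each $\mathcal{A}_{\delta,\mu}$ is finitely hereditary upward, that is, for any $A\in \mathcal{A}_{\delta,\mu}$ there is a finite set $F\subset\mathbb{N}_0$ such that $B\supset A\cap F$ implies $B\in\mathcal{A}_{\delta,\mu}$; (2) $\mathcal{A}$ is uniformly left-invariant, that is, for any $A\in \mathcal{A}$ there is some $\delta\in D$ such that, for all $n\geq 0$, $A-n\in \mathcal{A}_\delta$. In the claim, such a representation is fixed. A point $x\in X$ is called $\mathcal{A}$-universal for $(T_n)$ if, for any non-empty open set $U$ in $Y$, $\{ n\geq 0 : T_nx\in U\}\in \mathcal{A}$; $(T_n)$ is called $\mathcal{A}$-universal if such a point exists. The topology of a metrizable topological vector space (over $\mathbb{R}$ or $\mathbb{C}$)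 may be defined by an F-norm, that is, a function $\|\cdot\|\ge 0$ with $\|x+y\|\leq\|x\|+\|y\|$, $\|\lambda x\|\leq\|x\|$ for $|\lambda|\leq 1$, $\lim_{\lambda\to 0}\|\lambda x\|=0$, and $\|x\|=0$ only if $x=0$. The symbol $\|\cdot\|$ denotes a fixed F-norm defining the topology of the space in question. An F-space is a metrizable topological vector space that is complete under some (equivalently any) F-norm defining its topology. Sums over subsets of $\mathbb{N}_0$ are taken in increasing order of the index. A set is residual if it contains a countable intersection of dense open sets. *)

theory Defs
  imports "HOL-Analysis.Analysis"
begin

section \<open>Topological vector spaces and F-spaces\<close>

text \<open>
  The scalars range over the class \<open>real_normed_field\<close>, whose norm is multiplicative. By the
  Gelfand--Mazur theorem its only members are, up to isometric isomorphism, the real and the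
  complex numbers. The library has no type class of topological vector spaces over such a field,
  so scalar multiplication is an explicit parameter; the continuity of addition and negation comes
  from the class \<open>topological_ab_group_add\<close>.
\<close>

locale topological_vector_space = vector_space sc
  for sc :: "'k::real_normed_field \<Rightarrow> 'a::topological_ab_group_add \<Rightarrow> 'a" +
  assumes continuous_scale: "continuous_on UNIV (\<lambda>(c, x). sc c x)"

definition metrizable_tvs ::
    "('k::real_normed_field \<Rightarrow> 'a::topological_ab_group_add \<Rightarrow> 'a) \<Rightarrow> bool" where
  "metrizable_tvs sc \<longleftrightarrow>
     topological_vector_space sc \<and> metrizable_space (euclidean :: 'a topology)"

definition F_norm ::
    "('k::real_normed_field \<Rightarrow> 'a::topological_ab_group_add \<Rightarrow> 'a) \<Rightarrow> ('a \<Rightarrow> real) \<Rightarrow> bool" where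
  "F_norm sc p \<longleftrightarrow>
     (\<forall>x. 0 \<le> p x) \<and>
     (\<forall>x y. p (x + y) \<le> p x + p y) \<and>
     (\<forall>c x. norm c \<le> 1 \<longrightarrow> p (sc c x) \<le> p x) \<and>
     (\<forall>x. ((\<lambda>c. p (sc c x)) \<longlongrightarrow> 0) (at 0)) \<and>
     (\<forall>x. p x = 0 \<longrightarrow> x = 0)"

definition F_norm_dist :: "('a::ab_group_add \<Rightarrow> real) \<Rightarrow> 'a \<Rightarrow> 'a \<Rightarrow> real" where
  "F_norm_dist p x y = p (x - y)"

definition defining_F_norm ::
    "('k::real_normed_field \<Rightarrow> 'a::topological_ab_group_add \<Rightarrow> 'a) \<Rightarrow> ('a \<Rightarrow> real) \<Rightarrow> bool" where
  "defining_F_norm sc p \<longleftrightarrow>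
     F_norm sc p \<and> Metric_space.mtopology UNIV (F_norm_dist p) = euclidean"

definition F_space ::
    "('k::real_normed_field \<Rightarrow> 'a::topological_ab_group_add \<Rightarrow> 'a) \<Rightarrow> bool" where
  "F_space sc \<longleftrightarrow>
     metrizable_tvs sc \<and>
     (\<exists>p. defining_F_norm sc p \<and> Metric_space.mcomplete UNIV (F_norm_dist p))"

definition residual :: "'a::topological_space set \<Rightarrow> bool" where
  "residual R \<longleftrightarrow>
     (\<exists>\<G>. countable \<G> \<and> (\<forall>G\<in>\<G>. open G \<and> closure G = UNIV) \<and> \<Inter>\<G> \<subseteq> R)"

section \<open>Furstenberg families\<close>

definition furstenberg_family :: "nat set set \<Rightarrow> bool" where
  "furstenberg_family \<A> \<longleftrightarrow> \<A> \<noteq> {} \<and> (\<forall>A\<in>\<A>. \<forall>B. A \<subseteq> B \<longrightarrow> B \<in> \<A>)"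

definition proper_family :: "nat set set \<Rightarrow> bool" where
  "proper_family \<A> \<longleftrightarrow> {} \<notin> \<A>"

definition finitely_hereditary_upward :: "nat set set \<Rightarrow> bool" where
  "finitely_hereditary_upward \<C> \<longleftrightarrow>
     (\<forall>A\<in>\<C>. \<exists>F. finite F \<and> (\<forall>B. A \<inter> F \<subseteq> B \<longrightarrow> B \<in> \<C>))"

definition left_shift :: "nat set \<Rightarrow> nat \<Rightarrow> nat set" where
  "left_shift A n = {k - n | k. k \<in> A \<and> n \<le> k}"

text \<open>For a doubly indexed system \<open>\<C>\<close> of families, \<open>section_family M \<C> \<delta>\<close> is the family
  \<open>\<A>\<^sub>\<delta> = (\<Inter>\<mu>\<in>M. \<A>\<^sub>\<delta>\<^sub>,\<^sub>\<mu>)\<close>. Since an index type cannot be quantified existentially, the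
  representation of an upper family is carried along explicitly.\<close>

definition section_family :: "'m set \<Rightarrow> ('d \<Rightarrow> 'm \<Rightarrow> nat set set) \<Rightarrow> 'd \<Rightarrow> nat set set" where
  "section_family M \<C> \<delta> = (\<Inter>\<mu>\<in>M. \<C> \<delta> \<mu>)"

definition uniformly_left_invariant ::
    "nat set set \<Rightarrow> 'd set \<Rightarrow> 'm set \<Rightarrow> ('d \<Rightarrow> 'm \<Rightarrow> nat set set) \<Rightarrow> bool" where
  "uniformly_left_invariant \<A> D M \<C> \<longleftrightarrow>
     (\<forall>A\<in>\<A>. \<exists>\<delta>\<in>D. \<forall>n. left_shift A n \<in> section_family M \<C> \<delta>)"

definition upper_furstenberg_family ::
    "nat set set \<Rightarrow> 'd set \<Rightarrow> 'm set \<Rightarrow> ('d \<Rightarrow> 'm \<Rightarrow> nat set set) \<Rightarrow> bool" where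
  "upper_furstenberg_family \<A> D M \<C> \<longleftrightarrow>
     furstenberg_family \<A> \<and> proper_family \<A> \<and>
     countable M \<and> \<A> = (\<Union>\<delta>\<in>D. section_family M \<C> \<delta>) \<and>
     (\<forall>\<delta>\<in>D. \<forall>\<mu>\<in>M. finitely_hereditary_upward (\<C> \<delta> \<mu>)) \<and>
     uniformly_left_invariant \<A> D M \<C>"

section \<open>Universality\<close>

definition universal_vector ::
    "nat set set \<Rightarrow> (nat \<Rightarrow> 'a \<Rightarrow> 'b::topological_space) \<Rightarrow> 'a \<Rightarrow> bool" where
  "universal_vector \<A> T x \<longleftrightarrow> (\<forall>U. open U \<and> U \<noteq> {} \<longrightarrow> {n. T n x \<in> U} \<in> \<A>)"

definition universal_sequence ::
    "nat set set \<Rightarrow> (nat \<Rightarrow> 'a \<Rightarrow> 'b::topological_space) \<Rightarrow> bool" where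
  "universal_sequence \<A> T \<longleftrightarrow> (\<exists>x. universal_vector \<A> T x)"

text \<open>Summation over a set of indices in increasing order: extending the summands by zero off
  \<open>A\<close> only repeats partial sums, so it changes neither convergence nor the limit.\<close>

definition restrict_seq :: "nat set \<Rightarrow> (nat \<Rightarrow> 'a::zero) \<Rightarrow> nat \<Rightarrow> 'a" where
  "restrict_seq A f n = (if n \<in> A then f n else 0)"

end

theory Submission
  imports Defs
begin

text \<open>
  Universality for a family \<open>\<A>\<close> reduces to a Baire category argument. Fix an open set \<open>V\<close> of the
  target space and an index \<open>\<delta>\<close>. A family that is finitely hereditary upward detects membership of
  \<open>{n. T n x \<in> V}\<close> from finitely many times \<open>n\<close>, and finitely many conditions \<open>T n x \<in> V\<close> persist
  near \<open>x\<close>; hence the points whose visit times lie in \<open>\<C> \<delta> \<mu>\<close> form an open set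
  (\<open>open_visits_in_finitely_hereditary\<close>). So the points whose visit times lie in
  \<open>section_family M \<C> \<delta>\<close> form a countable intersection of open sets, as \<open>M\<close> is countable.

  If for every \<open>V\<close> some \<open>\<delta>\<close> makes this set dense, then letting \<open>V\<close> run through a countable
  \<open>\<pi>\<close>-base of the target (available since it is separable and metrizable) yields a countable
  intersection of dense open sets that consists of universal vectors (\<open>residual_universal_vectors\<close>).
  The choice of \<open>\<delta>\<close> must depend on \<open>V\<close> alone: were it allowed to vary with the point, one would have
  to intersect unions, over the arbitrary index set \<open>D\<close>, of countable intersections of open sets, and
  for such a union density does not imply residuality.

  The hypotheses of the theorem provide this density. Given \<open>V\<close>, take \<open>y \<in> Y\<^sub>0 \<inter> V\<close> and the set
  \<open>A\<close>, the index \<open>\<delta>\<close> and the sum \<open>s = (\<Sum>n\<in>A. S n y)\<close> that belong to \<open>y\<close> and a small \<open>\<epsilon>\<close>. The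
  vector \<open>s\<close> is in general not small, but this does not matter: translation by \<open>s\<close> is a
  homeomorphism, so \<open>X\<^sub>0 + s\<close> is as dense as \<open>X\<^sub>0\<close>. For \<open>x \<in> X\<^sub>0\<close> there is \<open>B \<subseteq> A\<close> in
  \<open>section_family M \<C> \<delta>\<close> with \<open>T n x\<close> small and \<open>T n s\<close> close to \<open>y\<close> for all \<open>n \<in> B\<close>, so that the
  orbit of \<open>x + s\<close> visits \<open>V\<close> at all times in \<open>B\<close>.
\<close>

section \<open>F-norms and metrics\<close>

lemma F_norm_minus:
  fixes sc :: "'b::real_normed_field \<Rightarrow> 'a::topological_ab_group_add \<Rightarrow> 'a"
  assumes "vector_space sc" "F_norm sc p"
  shows "p (- x) = p x"
proof -
  interpret vector_space sc by fact
  have le: "p (- z) \<le> p z" for z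
  proof -
    have "norm (- 1 :: 'b) \<le> 1 \<longrightarrow> p (sc (- 1) z) \<le> p z"
      using assms(2) unfolding F_norm_def by blast
    then show ?thesis
      by simp
  qed
  from le[of x] le[of "- x"] show ?thesis by simp
qed

text \<open>For \<open>x = 0\<close> the axiom \<open>p (c \<cdot> x) \<rightarrow> 0\<close> as \<open>c \<rightarrow> 0\<close> concerns a constant function of \<open>c\<close>, and the
  scalar \<open>0\<close> is not isolated.\<close>

lemma F_norm_zero:
  assumes "vector_space sc" "F_norm sc p"
  shows "p 0 = 0"
proof -
  interpret vector_space sc by fact
  have "((\<lambda>c. p (sc c 0)) \<longlongrightarrow> 0) (at 0)"
    using assms(2) unfolding F_norm_def by blast
  then show ?thesis
    by (simp add: tendsto_const_iff)
qed

lemma Metric_space_F_norm_dist: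
  assumes "vector_space sc" "F_norm sc p"
  shows "Metric_space UNIV (F_norm_dist p)"
proof
  fix x y z
  show "0 \<le> F_norm_dist p x y"
    using assms(2) by (simp add: F_norm_def F_norm_dist_def)
  show "F_norm_dist p x y = F_norm_dist p y x"
    using F_norm_minus[OF assms, of "x - y"] by (simp add: F_norm_dist_def)
  have "p (x - y) = 0 \<Longrightarrow> x - y = 0"
    using assms(2) unfolding F_norm_def by blast
  then show "(F_norm_dist p x y = 0) = (x = y)"
    using F_norm_zero[OF assms] by (auto simp: F_norm_dist_def)
  have "p ((x - y) + (y - z)) \<le> p (x - y) + p (y - z)"
    using assms(2) unfolding F_norm_def by blast
  then show "F_norm_dist p x z \<le> F_norm_dist p x y + F_norm_dist p y z"
    by (simp add: F_norm_dist_def)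
qed

lemma defining_F_norm_ball_subset:
  assumes "vector_space sc" "defining_F_norm sc p" "open V" "y \<in> V"
  obtains r where "r > 0" "\<And>z. p (z - y) < r \<Longrightarrow> z \<in> V"
proof -
  have p: "F_norm sc p" "Metric_space.mtopology UNIV (F_norm_dist p) = euclidean"
    using assms(2) by (auto simp: defining_F_norm_def)
  interpret Metric_space UNIV "F_norm_dist p"
    by (rule Metric_space_F_norm_dist) fact+
  have "openin mtopology V"
    using assms(3) p(2) by simp
  then obtain r where "r > 0" "mball y r \<subseteq> V"
    using assms(4) by (auto simp: openin_mtopology)
  moreover have "z \<in> mball y r" if "p (z - y) < r" for z
    using that F_norm_minus[OF assms(1) p(1), of "y - z"] by (simp add: F_norm_dist_def)
  ultimately show ?thesis
    using that by blast
qed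

section \<open>Category in separable and in complete metrizable spaces\<close>

text \<open>A member of a \<open>\<pi>\<close>-base has to fit inside a given open set but need not contain a prescribed point
  of it, so balls about the points of a countable dense set will do.\<close>

lemma (in Metric_space) countable_pi_base:
  assumes "separable_space mtopology"
  obtains \<B> where "countable \<B>" "\<And>W. W \<in> \<B> \<Longrightarrow> openin mtopology W \<and> W \<noteq> {}"
    "\<And>V. openin mtopology V \<Longrightarrow> V \<noteq> {} \<Longrightarrow> \<exists>W\<in>\<B>. W \<subseteq> V"
proof -
  obtain C where C: "countable C" "C \<subseteq> M" "mtopology closure_of C = M"
    using assms by (auto simp: separable_space_def)
  define \<B> where "\<B> = (\<lambda>(c, n). mball c (inverse (real (Suc n)))) ` (C \<times> (UNIV :: nat set))"
  show ?thesis
  proof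
    show "countable \<B>"
      using C(1) by (simp add: \<B>_def)
    show "openin mtopology W \<and> W \<noteq> {}" if "W \<in> \<B>" for W
      using that C(2) by (force simp: \<B>_def)
    show "\<exists>W\<in>\<B>. W \<subseteq> V" if V: "openin mtopology V" "V \<noteq> {}" for V
    proof -
      have "V \<inter> C \<noteq> {}"
        using V C(3) dense_intersects_open[of mtopology C] by auto
      then obtain c where c: "c \<in> C" "c \<in> V"
        by blast
      then obtain r where r: "r > 0" "mball c r \<subseteq> V"
        using V(1) by (auto simp: openin_mtopology)
      obtain n where "inverse (real (Suc n)) < r"
        using reals_Archimedean[OF r(1)] by blast
      then have "mball c (inverse (real (Suc n))) \<subseteq> V"
        using r(2) mball_subset_concentric[of "inverse (real (Suc n))" r c] by auto
      then show ?thesis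
        using c(1) unfolding \<B>_def by force
    qed
  qed
qed

lemma residual_imp_nonempty:
  fixes R :: "'a::topological_space set"
  assumes "completely_metrizable_space (euclidean :: 'a topology)" "residual R"
  shows "R \<noteq> {}"
proof -
  obtain \<G> where \<G>: "countable \<G>" "\<forall>G\<in>\<G>. open G \<and> closure G = (UNIV :: 'a set)" "\<Inter>\<G> \<subseteq> R"
    using assms(2) by (auto simp: residual_def)
  have "euclidean closure_of \<Inter>\<G> = topspace (euclidean :: 'a topology)"
    by (rule Baire_category) (use assms(1) \<G> in auto)
  then have "\<Inter>\<G> \<noteq> {}"
    by auto
  with \<G>(3) show ?thesis
    by blast
qed

section \<open>Residual sets of universal vectors\<close>

text \<open>Membership of the set of visit times in \<open>\<F>\<close> is witnessed by finitely many visits, and each of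
  these is an open condition on the point.\<close>

lemma open_visits_in_finitely_hereditary:
  fixes T :: "nat \<Rightarrow> 'a::topological_space \<Rightarrow> 'b::topological_space"
  assumes \<F>: "finitely_hereditary_upward \<F>"
    and T: "\<And>n. continuous_on UNIV (T n)" and V: "open V"
  shows "open {x. {n. T n x \<in> V} \<in> \<F>}"
proof (subst open_subopen, intro ballI)
  fix x assume "x \<in> {x. {n. T n x \<in> V} \<in> \<F>}"
  then obtain F where F: "finite F" "\<And>B. {n. T n x \<in> V} \<inter> F \<subseteq> B \<Longrightarrow> B \<in> \<F>"
    using \<F> unfolding finitely_hereditary_upward_def by blast
  define N where "N = (\<Inter>n\<in>{n. T n x \<in> V} \<inter> F. T n -` V)"
  have "open N"
    unfolding N_def using F(1) T V by (intro open_INT ballI open_vimage) auto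
  moreover have "x \<in> N"
    by (auto simp: N_def)
  moreover have "{n. T n z \<in> V} \<in> \<F>" if "z \<in> N" for z
    by (rule F(2)) (use that in \<open>auto simp: N_def\<close>)
  ultimately show "\<exists>N. open N \<and> x \<in> N \<and> N \<subseteq> {x. {n. T n x \<in> V} \<in> \<F>}"
    by blast
qed

lemma section_family_superset:
  assumes "upper_furstenberg_family \<A> D M \<C>" "\<delta> \<in> D"
    "A \<in> section_family M \<C> \<delta>" "A \<subseteq> B"
  shows "B \<in> section_family M \<C> \<delta>"
proof -
  have "B \<in> \<C> \<delta> \<mu>" if \<mu>: "\<mu> \<in> M" for \<mu>
  proof -
    have "finitely_hereditary_upward (\<C> \<delta> \<mu>)" "A \<in> \<C> \<delta> \<mu>"
      using assms(1-3) \<mu> by (auto simp: upper_furstenberg_family_def section_family_def)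
    then obtain F where "\<And>B. A \<inter> F \<subseteq> B \<Longrightarrow> B \<in> \<C> \<delta> \<mu>"
      unfolding finitely_hereditary_upward_def by blast
    then show ?thesis
      using assms(4) by blast
  qed
  then show ?thesis
    by (simp add: section_family_def)
qed

text \<open>The topological core. In \<open>dense\<close> the index \<open>\<delta>\<close> is chosen before \<open>U\<close>, which makes the set of
  points with visit times in \<open>section_family M \<C> \<delta>\<close> dense for a single \<open>\<delta>\<close>. It suffices to treat the
  sets of a countable \<open>\<pi>\<close>-base, because \<open>\<A>\<close> is hereditary upward.\<close>

lemma residual_universal_vectors:
  fixes T :: "nat \<Rightarrow> 'a::topological_space \<Rightarrow> 'b::topological_space"
    and \<B> :: "'b set set"
  assumes \<A>: "upper_furstenberg_family \<A> D M \<C>"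
    and T: "\<And>n. continuous_on UNIV (T n)"
    and \<B>: "countable \<B>" "\<And>W. W \<in> \<B> \<Longrightarrow> open W \<and> W \<noteq> {}"
      "\<And>V. open V \<Longrightarrow> V \<noteq> {} \<Longrightarrow> \<exists>W\<in>\<B>. W \<subseteq> V"
    and dense: "\<And>V. open V \<Longrightarrow> V \<noteq> {} \<Longrightarrow>
      \<exists>\<delta>\<in>D. \<forall>U. open U \<and> U \<noteq> {} \<longrightarrow> (\<exists>x\<in>U. {n. T n x \<in> V} \<in> section_family M \<C> \<delta>)"
  shows "residual {x. universal_vector \<A> T x}"
proof -
  obtain d where d: "\<And>W. W \<in> \<B> \<Longrightarrow> d W \<in> D"
    "\<And>W U. W \<in> \<B> \<Longrightarrow> open U \<Longrightarrow> U \<noteq> {} \<Longrightarrow>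
      \<exists>x\<in>U. {n. T n x \<in> W} \<in> section_family M \<C> (d W)"
    using dense \<B>(2) by metis
  define G where "G W \<mu> = {x. {n. T n x \<in> W} \<in> \<C> (d W) \<mu>}" for W \<mu>
  define \<G> where "\<G> = (\<lambda>(W, \<mu>). G W \<mu>) ` (\<B> \<times> M)"
  have "countable \<G>"
    using \<A> \<B>(1) by (simp add: \<G>_def upper_furstenberg_family_def)
  moreover have "open (G W \<mu>) \<and> closure (G W \<mu>) = UNIV" if W: "W \<in> \<B>" and \<mu>: "\<mu> \<in> M" for W \<mu>
  proof
    show "open (G W \<mu>)"
      unfolding G_def
    proof (rule open_visits_in_finitely_hereditary)
      show "finitely_hereditary_upward (\<C> (d W) \<mu>)"
        using \<A> d(1)[OF W] \<mu> by (simp add: upper_furstenberg_family_def)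
    qed (use T \<B>(2) W in auto)
    have "U \<inter> G W \<mu> \<noteq> {}" if "open U" "U \<noteq> {}" for U
      using d(2)[OF W that] \<mu> by (auto simp: section_family_def G_def)
    from this[of "- closure (G W \<mu>)"] closure_subset[of "G W \<mu>"]
    show "closure (G W \<mu>) = UNIV"
      by blast
  qed
  moreover have "\<Inter>\<G> \<subseteq> {x. universal_vector \<A> T x}"
  proof
    fix x assume x: "x \<in> \<Inter>\<G>"
    have "{n. T n x \<in> V} \<in> \<A>" if V: "open V" "V \<noteq> {}" for V
    proof -
      obtain W where W: "W \<in> \<B>" "W \<subseteq> V"
        using \<B>(3)[OF V] by blast
      have "{n. T n x \<in> W} \<in> section_family M \<C> (d W)"
        using x W(1) by (auto simp: \<G>_def G_def section_family_def)
      then have "{n. T n x \<in> W} \<in> \<A>"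
        using \<A> d(1)[OF W(1)] by (auto simp: upper_furstenberg_family_def)
      moreover have "{n. T n x \<in> W} \<subseteq> {n. T n x \<in> V}"
        using W(2) by blast
      ultimately show ?thesis
        using \<A> unfolding upper_furstenberg_family_def furstenberg_family_def by blast
    qed
    then show "x \<in> {x. universal_vector \<A> T x}"
      by (simp add: universal_vector_def)
  qed
  ultimately show ?thesis
    unfolding residual_def \<G>_def by (intro exI[of _ "(\<lambda>(W, \<mu>). G W \<mu>) ` (\<B> \<times> M)"]) auto
qed

section \<open>The universality criterion\<close>

lemma dense_translate_meets_open:
  fixes S :: "'a::topological_ab_group_add set"
  assumes "closure S = UNIV" "open U" "U \<noteq> {}"
  obtains x where "x \<in> S" "x + s \<in> U"
proof -
  have "continuous_on UNIV (\<lambda>x. x + s)"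
    by (intro continuous_on_add continuous_on_id continuous_on_const)
  then have "open ((\<lambda>x. x + s) -` U)"
    using assms(2) by (simp add: open_vimage)
  moreover have "(\<lambda>x. x + s) -` U \<noteq> {}"
  proof -
    obtain u where "u \<in> U"
      using assms(3) by blast
    then have "u - s \<in> (\<lambda>x. x + s) -` U"
      by simp
    then show ?thesis
      by blast
  qed
  ultimately have "(\<lambda>x. x + s) -` U \<inter> S \<noteq> {}"
    using assms(1) open_Int_closure_eq_empty[of "(\<lambda>x. x + s) -` U" S] by auto
  then show ?thesis
    using that by blast
qed

theorem theorem22:
  fixes scaleX :: "'k::real_normed_field \<Rightarrow> 'x::topological_ab_group_add \<Rightarrow> 'x"
    and scaleY :: "'k \<Rightarrow> 'y::topological_ab_group_add \<Rightarrow> 'y"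
    and normY :: "'y \<Rightarrow> real"
    and T :: "nat \<Rightarrow> 'x \<Rightarrow> 'y"
    and \<A> :: "nat set set"
    and D :: "'d set" and M :: "'m set" and \<C> :: "'d \<Rightarrow> 'm \<Rightarrow> nat set set"
    and X\<^sub>0 :: "'x set" and Y\<^sub>0 :: "'y set"
    and S :: "nat \<Rightarrow> 'y \<Rightarrow> 'x"
  assumes X: "F_space scaleX"
    and Y: "metrizable_tvs scaleY" "separable_space (euclidean :: 'y topology)"
    and normY: "defining_F_norm scaleY normY"
    and T: "\<And>n. Vector_Spaces.linear scaleX scaleY (T n)" "\<And>n. continuous_on UNIV (T n)"
    and \<A>: "upper_furstenberg_family \<A> D M \<C>"
    and X\<^sub>0: "closure X\<^sub>0 = UNIV"
    and Y\<^sub>0: "closure Y\<^sub>0 = UNIV"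
    and criterion: "\<And>y \<epsilon>. y \<in> Y\<^sub>0 \<Longrightarrow> \<epsilon> > 0 \<Longrightarrow>
      \<exists>A\<in>\<A>. \<exists>\<delta>\<in>D.
        (\<forall>x\<in>X\<^sub>0. \<exists>B\<in>section_family M \<C> \<delta>. B \<subseteq> A \<and> (\<forall>n\<in>B. normY (T n x) < \<epsilon>)) \<and>
        summable (restrict_seq A (\<lambda>n. S n y)) \<and>
        (\<forall>m\<in>A. normY (T m (suminf (restrict_seq A (\<lambda>n. S n y))) - y) < \<epsilon>)"
  shows "universal_sequence \<A> T \<and> residual {x. universal_vector \<A> T x}"
proof -
  have vsY: "vector_space scaleY"
    using Y(1) by (simp add: metrizable_tvs_def topological_vector_space_def)
  have vsX: "vector_space scaleX"
    using X by (simp add: F_space_def metrizable_tvs_def topological_vector_space_def)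
  have FY: "F_norm scaleY normY" and topY: "Metric_space.mtopology UNIV (F_norm_dist normY) = euclidean"
    using normY by (auto simp: defining_F_norm_def)

  obtain p where p: "F_norm scaleX p" "Metric_space.mtopology UNIV (F_norm_dist p) = euclidean"
    "Metric_space.mcomplete UNIV (F_norm_dist p)"
    using X by (auto simp: F_space_def defining_F_norm_def)
  have complete: "completely_metrizable_space (euclidean :: 'x topology)"
    using Metric_space.completely_metrizable_space_mtopology
      [OF Metric_space_F_norm_dist[OF vsX p(1)] p(3)] p(2)
    by simp

  interpret mY: Metric_space UNIV "F_norm_dist normY"
    by (rule Metric_space_F_norm_dist[OF vsY FY])
  have "separable_space mY.mtopology"
    using Y(2) topY by simp
  then obtain \<B> :: "'y set set" where \<B>: "countable \<B>" "\<And>W. W \<in> \<B> \<Longrightarrow> open W \<and> W \<noteq> {}"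
    "\<And>V. open V \<Longrightarrow> V \<noteq> {} \<Longrightarrow> \<exists>W\<in>\<B>. W \<subseteq> V"
    using mY.countable_pi_base unfolding topY open_openin[symmetric] by blast

  have dense: "\<exists>\<delta>\<in>D. \<forall>U. open U \<and> U \<noteq> {} \<longrightarrow> (\<exists>x\<in>U. {n. T n x \<in> V} \<in> section_family M \<C> \<delta>)"
    if V: "open V" "V \<noteq> {}" for V
  proof -
    obtain y where y: "y \<in> Y\<^sub>0" "y \<in> V"
      using V Y\<^sub>0 open_Int_closure_eq_empty[of V Y\<^sub>0] by auto
    obtain r where r: "r > 0" "\<And>z. normY (z - y) < r \<Longrightarrow> z \<in> V"
      using defining_F_norm_ball_subset[OF vsY normY V(1) y(2)] by blast
    obtain A \<delta> where \<delta>: "\<delta> \<in> D"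
      and small: "\<And>x. x \<in> X\<^sub>0 \<Longrightarrow>
        \<exists>B\<in>section_family M \<C> \<delta>. B \<subseteq> A \<and> (\<forall>n\<in>B. normY (T n x) < r / 2)"
      and near: "\<forall>m\<in>A. normY (T m (suminf (restrict_seq A (\<lambda>n. S n y))) - y) < r / 2"
      using criterion[OF y(1), of "r / 2"] r(1) by auto
    define s where "s = suminf (restrict_seq A (\<lambda>n. S n y))"
    have "\<exists>x\<in>U. {n. T n x \<in> V} \<in> section_family M \<C> \<delta>" if U: "open U" "U \<noteq> {}" for U
    proof -
      \<comment> \<open>The size of \<open>s\<close> is unknown; the summand \<open>x\<close> compensates for it and brings \<open>x + s\<close> into \<open>U\<close>.\<close>
      obtain x where x: "x \<in> X\<^sub>0" "x + s \<in> U"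
        using dense_translate_meets_open[OF X\<^sub>0 U] by blast
      obtain B where B: "B \<in> section_family M \<C> \<delta>" "B \<subseteq> A" "\<forall>n\<in>B. normY (T n x) < r / 2"
        using small[OF x(1)] by blast
      have "T n (x + s) \<in> V" if n: "n \<in> B" for n
      proof (rule r(2))
        have "normY (T n (x + s) - y) = normY (T n x + (T n s - y))"
          using module_hom.add[OF Vector_Spaces.linear.axioms(3)[OF T(1)[of n]], of x s]
          by (simp add: algebra_simps)
        moreover have "normY (T n x + (T n s - y)) \<le> normY (T n x) + normY (T n s - y)"
          using FY unfolding F_norm_def by blast
        moreover have "normY (T n x) < r / 2" "normY (T n s - y) < r / 2"
          using B n near by (auto simp: s_def)
        ultimately show "normY (T n (x + s) - y) < r"
          by linarith
      qed
      then have "{n. T n (x + s) \<in> V} \<in> section_family M \<C> \<delta>"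
        by (intro section_family_superset[OF \<A> \<delta> B(1)]) blast
      with x(2) show ?thesis
        by blast
    qed
    with \<delta> show ?thesis
      by blast
  qed

  have "residual {x. universal_vector \<A> T x}"
    by (rule residual_universal_vectors[OF \<A> T(2) \<B> dense])
  moreover from residual_imp_nonempty[OF complete this] have "universal_sequence \<A> T"
    by (auto simp: universal_sequence_def)
  ultimately show ?thesis
    by blast
qed

end
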